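(* Let $\mathbb{M}$ be a monoid, let $A$ and $B$ be countable alphabets, and let $\Lambda\subset A^{\mathbb{M}}$ be a shift space. A map $\Phi:\Lambda\to B^{\mathbb{M}}$ is a generalized sliding block code if, and only if, it is continuous and commutes with all translations, that is, $\Phi\circ\sigma^g=\sigma^g\circ\Phi$ for all $g\in\mathbb{M}$.
   Context: Let $\mathbb{M}$ be a monoid with identity $1$ and operation written $gh$. A countable alphabet may be finite or infinite. For a countable alphabet $A$ with the discrete topology, $A^{\mathbb{M}}$ is the set of all sequences $\mathbf{x}=(x_i)_{i\in\mathbb{M}}$ over $A$ indexed by $\mathbb{M}$, with the product topology; likewise for $B^{\mathbb{M}}$. Cylinders: given a finite subset $D\subset\mathbb{M}$ and $(a_i)_{i\in D}\in A^{D}$, the corresponding cylinder is $[(a_i)_{i\in D}]_D:=\{\mathbf{x}\in A^{\mathbb{M}}: x_i=a_i\ \forall i\in D\}$. Cylinders form a basis of the product topology. A cylinder of $\Lambda\subset A^{\mathbb{M}}$ is the intersection of $\Lambda$ with a cylinder of $A^{\mathbb{M}}$. Translations: for $g\in\mathbb{M}$, the translation $\sigma^g:A^{\mathbb{M}}\to A^{\mathbb{M}}$ is $\sigma^g\big((x_i)_{i\in\mathbb{M}}\big)=(x_{gi})_{i\in\mathbb{M}}$; the same notation is used on $B^{\mathbb{M}}$. Shift space: a set $\Lambda\subset A^{\mathbb{M}}$ that is closed in $A^{\mathbb{M}}$ and satisfies $\sigma^g(\Lambda)\subset\Lambda$ for all $g\in\mathbb{M}$. It carries the topology induced from $A^{\mathbb{M}}$.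 Generalized sliding block code: a map $\Phi:\Lambda\to B^{\mathbb{M}}$ such that there exists a partition $\{C_b\}_{b\in B}$ of $\Lambda$ (i.e. pairwise disjoint sets, some possibly empty, whose union is $\Lambda$), where each nonempty $C_b$ is a union (of arbitrarily many) cylinders of $\Lambda$, such that $$\bigl(\Phi(\mathbf{x})\bigr)_g=\sum_{b\in B}b\,\mathbf{1}_{C_b}\circ\sigma^g(\mathbf{x}),\quad \forall\,\mathbf{x}\in\Lambda,\ \forall\, g\in\mathbb{M},$$ where $\mathbf{1}_{C_b}$ is the characteristic function of $C_b$ and $\sum$ is the symbolic sum; that is, $\bigl(\Phi(\mathbf{x})\bigr)_g$ is the unique $b\in B$ with $\sigma^g(\mathbf{x})\in C_b$. *)

theory Defs
  imports "HOL-Analysis.Analysis" "HOL-Algebra.Group"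
begin

text \<open>
  Configurations are extensional functions on the carrier: \<open>A\<^sup>M\<close> is \<open>carrier M \<rightarrow>\<^sub>E A\<close>. This is also
  the underlying set of the library's \<open>product_topology\<close>, and it makes equality of configurations
  the same as equality at all elements of the monoid.
\<close>

definition full_shift :: "('m, 'z) monoid_scheme \<Rightarrow> 'a set \<Rightarrow> ('m \<Rightarrow> 'a) set" where
  "full_shift M A = carrier M \<rightarrow>\<^sub>E A"

definition shift_topology :: "('m, 'z) monoid_scheme \<Rightarrow> 'a set \<Rightarrow> ('m \<Rightarrow> 'a) topology" where
  "shift_topology M A = product_topology (\<lambda>_. discrete_topology A) (carrier M)"

lemma topspace_shift_topology: "topspace (shift_topology M A) = full_shift M A"
  by (simp add: shift_topology_def full_shift_def)

text \<open>The index is multiplied on the right of \<open>g\<close>; \<open>M\<close> need not be commutative.\<close>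

definition translation :: "('m, 'z) monoid_scheme \<Rightarrow> 'm \<Rightarrow> ('m \<Rightarrow> 'a) \<Rightarrow> 'm \<Rightarrow> 'a" where
  "translation M g x = (\<lambda>i\<in>carrier M. x (g \<otimes>\<^bsub>M\<^esub> i))"

definition cylinder ::
    "('m, 'z) monoid_scheme \<Rightarrow> 'a set \<Rightarrow> 'm set \<Rightarrow> ('m \<Rightarrow> 'a) \<Rightarrow> ('m \<Rightarrow> 'a) set" where
  "cylinder M A D a = {x \<in> full_shift M A. \<forall>i\<in>D. x i = a i}"

definition cylinders_of ::
    "('m, 'z) monoid_scheme \<Rightarrow> 'a set \<Rightarrow> ('m \<Rightarrow> 'a) set \<Rightarrow> ('m \<Rightarrow> 'a) set set" where
  "cylinders_of M A \<Lambda> =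
     {\<Lambda> \<inter> cylinder M A D a | D a. finite D \<and> D \<subseteq> carrier M \<and> a \<in> D \<rightarrow>\<^sub>E A}"

definition shift_space :: "('m, 'z) monoid_scheme \<Rightarrow> 'a set \<Rightarrow> ('m \<Rightarrow> 'a) set \<Rightarrow> bool" where
  "shift_space M A \<Lambda> \<longleftrightarrow>
     closedin (shift_topology M A) \<Lambda> \<and> (\<forall>g\<in>carrier M. translation M g ` \<Lambda> \<subseteq> \<Lambda>)"

text \<open>
  The predicate is meant for maps from \<open>\<Lambda>\<close> to \<open>full_shift M B\<close>; values of \<open>\<Phi>\<close> outside \<open>\<Lambda>\<close> play
  no role. The symbolic sum over \<open>b\<close> of \<open>b\<close> times the indicator of \<open>C b\<close> selects the unique
  \<open>b \<in> B\<close> whose block contains the point. Existence and uniqueness follow from the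
  partition when \<open>\<Lambda>\<close> is a shift space.
\<close>

definition generalized_sliding_block_code ::
    "('m, 'z) monoid_scheme \<Rightarrow> 'a set \<Rightarrow> 'b set \<Rightarrow> ('m \<Rightarrow> 'a) set
      \<Rightarrow> (('m \<Rightarrow> 'a) \<Rightarrow> 'm \<Rightarrow> 'b) \<Rightarrow> bool" where
  "generalized_sliding_block_code M A B \<Lambda> \<Phi> \<longleftrightarrow>
     (\<exists>C. disjoint_family_on C B \<and> (\<Union>b\<in>B. C b) = \<Lambda> \<and>
          (\<forall>b\<in>B. C b \<noteq> {} \<longrightarrow> (\<exists>Z \<subseteq> cylinders_of M A \<Lambda>. C b = \<Union>Z)) \<and>
          (\<forall>x\<in>\<Lambda>. \<forall>g\<in>carrier M. \<Phi> x g = (THE b. b \<in> B \<and> translation M g x \<in> C b)))"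

end

theory Submission
  imports Defs
begin

text \<open>
  Since cylinders form a base, a subset of \<open>\<Lambda>\<close> is relatively open iff it is a union of cylinders
  of \<open>\<Lambda>\<close>. A map commuting with translations is determined by its coordinate at the identity, and
  the fibres of that coordinate are the blocks \<open>C b\<close>; continuity says precisely that the fibres of
  all coordinates, which are the translation preimages of the \<open>C b\<close>, are open.
\<close>

text \<open>A cylinder is a box with singleton factors over \<open>D\<close> and full factors
  elsewhere; finiteness of \<open>D\<close> makes this box open.\<close>

lemma openin_cylinder:
  assumes "finite D" "D \<subseteq> carrier M" "a \<in> D \<rightarrow>\<^sub>E A"
  shows "openin (shift_topology M A) (cylinder M A D a)"
proof -
  have "cylinder M A D a = (\<Pi>\<^sub>E i\<in>carrier M. if i \<in> D then {a i} else A)"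
    using assms by (auto simp: cylinder_def full_shift_def PiE_iff extensional_def split: if_splits)
  moreover have "finite {i. (if i \<in> D then {a i} else A) \<noteq> A}"
    by (rule finite_subset[OF _ assms(1)]) auto
  ultimately show ?thesis
    using assms unfolding shift_topology_def
    by (auto simp: openin_PiE_gen PiE_iff elim: rev_finite_subset)
qed

lemma openin_cylinders_of:
  assumes "U \<in> cylinders_of M A \<Lambda>"
  shows "openin (subtopology (shift_topology M A) \<Lambda>) U"
  using assms by (auto simp: cylinders_of_def openin_cylinder openin_subtopology_Int2)

text \<open>An open set contains a basic box around \<open>x\<close> that constrains only finitely
  many coordinates. Fixing the values of \<open>x\<close> at these coordinates forces a
  configuration into the box.\<close>

lemma cylinder_neighbourhood:
  assumes "openin (shift_topology M A) U" "x \<in> U"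
  obtains D a where "finite D" "D \<subseteq> carrier M" "a \<in> D \<rightarrow>\<^sub>E A"
    "x \<in> cylinder M A D a" "cylinder M A D a \<subseteq> U"
proof -
  from assms obtain V where V: "finite {i \<in> carrier M. V i \<noteq> A}" "\<forall>i\<in>carrier M. V i \<subseteq> A"
    "x \<in> Pi\<^sub>E (carrier M) V" "Pi\<^sub>E (carrier M) V \<subseteq> U"
    unfolding shift_topology_def openin_product_topology_alt by auto
  define D where "D = {i \<in> carrier M. V i \<noteq> A}"
  have x: "x \<in> full_shift M A"
    using V(2,3) unfolding full_shift_def PiE_iff by blast
  \<comment> \<open>On \<open>D\<close> the value \<open>y i = x i\<close> lies in
    \<open>V i\<close>; elsewhere on the carrier \<open>V i\<close> is all of \<open>A\<close>. The
    pattern is \<open>restrict x D\<close> rather than \<open>x\<close>, since patterns are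
    extensional on \<open>D\<close>.\<close>
  have "y \<in> Pi\<^sub>E (carrier M) V" if y: "y \<in> cylinder M A D (restrict x D)" for y
  proof (rule PiE_I)
    fix i assume "i \<in> carrier M"
    then show "y i \<in> V i"
      using y V(3) by (cases "i \<in> D") (auto simp: cylinder_def full_shift_def D_def PiE_iff)
  next
    fix i assume "i \<notin> carrier M"
    then show "y i = undefined"
      using y by (auto simp: cylinder_def full_shift_def PiE_iff extensional_def)
  qed
  then have "cylinder M A D (restrict x D) \<subseteq> U"
    using V(4) by blast
  moreover have "restrict x D \<in> D \<rightarrow>\<^sub>E A"
    using x by (auto simp: full_shift_def D_def)
  moreover have "x \<in> cylinder M A D (restrict x D)"
    using x by (auto simp: cylinder_def)
  moreover have "finite D" "D \<subseteq> carrier M"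
    using V(1) by (auto simp: D_def)
  ultimately show thesis using that by blast
qed

text \<open>Serves to turn the condition on blocks into openness, which passes to preimages under
  continuous maps.\<close>

lemma openin_iff_Union_cylinders_of:
  "openin (subtopology (shift_topology M A) \<Lambda>) U \<longleftrightarrow> (\<exists>Z \<subseteq> cylinders_of M A \<Lambda>. U = \<Union>Z)"
proof
  assume "openin (subtopology (shift_topology M A) \<Lambda>) U"
  then obtain T where T: "openin (shift_topology M A) T" "U = T \<inter> \<Lambda>"
    by (auto simp: openin_subtopology)
  have "\<exists>W \<in> cylinders_of M A \<Lambda>. x \<in> W \<and> W \<subseteq> U" if x: "x \<in> U" for x
  proof -
    have "x \<in> T" using x T(2) by blast
    from cylinder_neighbourhood[OF T(1) this] obtain D a
      where "finite D" "D \<subseteq> carrier M" "a \<in> D \<rightarrow>\<^sub>E A" "x \<in> cylinder M A D a"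
        "cylinder M A D a \<subseteq> T" .
    then show ?thesis
      using x T(2) by (intro bexI[of _ "\<Lambda> \<inter> cylinder M A D a"]) (auto simp: cylinders_of_def)
  qed
  \<comment> \<open>The largest possible family is the witness: the neighbourhoods just found show
    that it covers \<open>U\<close>.\<close>
  then have "U = \<Union>{W \<in> cylinders_of M A \<Lambda>. W \<subseteq> U}"
    by blast
  then show "\<exists>Z \<subseteq> cylinders_of M A \<Lambda>. U = \<Union>Z"
    by (intro exI[of _ "{W \<in> cylinders_of M A \<Lambda>. W \<subseteq> U}"]) simp
next
  assume "\<exists>Z \<subseteq> cylinders_of M A \<Lambda>. U = \<Union>Z"
  then show "openin (subtopology (shift_topology M A) \<Lambda>) U"
    using openin_cylinders_of by blast
qed

lemma shift_space_subset: "shift_space M A \<Lambda> \<Longrightarrow> \<Lambda> \<subseteq> full_shift M A"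
  using closedin_subset unfolding shift_space_def by (metis topspace_shift_topology)

lemma shift_space_translation:
  "shift_space M A \<Lambda> \<Longrightarrow> g \<in> carrier M \<Longrightarrow> x \<in> \<Lambda> \<Longrightarrow> translation M g x \<in> \<Lambda>"
  unfolding shift_space_def by blast

text \<open>The order of the factors is reversed, as translations shift the index on the left.\<close>

lemma (in monoid) translation_translation:
  assumes "g \<in> carrier G" "h \<in> carrier G"
  shows "translation G h (translation G g x) = translation G (g \<otimes> h) x"
  using assms by (auto simp: translation_def m_assoc)

text \<open>Coordinate \<open>i\<close> of the translate is the projection to coordinate
  \<open>g \<otimes> i\<close>, hence continuous.\<close>

lemma (in monoid) continuous_map_translation:
  assumes "g \<in> carrier G"
  shows "continuous_map (shift_topology G A) (shift_topology G A) (translation G g)"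
  using assms unfolding shift_topology_def
  by (auto simp: continuous_map_componentwise translation_def intro!: continuous_map_product_projection)

lemma (in monoid) continuous_map_translation_shift_space:
  assumes "shift_space G A \<Lambda>" "g \<in> carrier G"
  shows "continuous_map (subtopology (shift_topology G A) \<Lambda>) (subtopology (shift_topology G A) \<Lambda>)
    (translation G g)"
  using assms shift_space_translation
  by (fastforce simp: continuous_map_in_subtopology continuous_map_from_subtopology
      continuous_map_translation)

text \<open>Continuity into a product is tested coordinatewise. For a discrete target it is enough
  to test fibres of points, because every preimage is a union of them.\<close>

lemma continuous_map_into_shift_topology:
  assumes "f \<in> topspace X \<rightarrow> full_shift M B"
  shows "continuous_map X (shift_topology M B) f \<longleftrightarrow>
    (\<forall>g\<in>carrier M. \<forall>b\<in>B. openin X {x \<in> topspace X. f x g = b})"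
proof -
  have ext: "f ` topspace X \<subseteq> extensional (carrier M)"
    using assms by (auto simp: full_shift_def PiE_iff)
  have "continuous_map X (discrete_topology B) (\<lambda>x. f x g) \<longleftrightarrow>
      (\<forall>b\<in>B. openin X {x \<in> topspace X. f x g = b})" if g: "g \<in> carrier M" for g
  proof
    assume c: "continuous_map X (discrete_topology B) (\<lambda>x. f x g)"
    have "openin X {x \<in> topspace X. f x g \<in> {b}}" if "b \<in> B" for b
      using that by (intro openin_continuous_map_preimage[OF c]) simp
    then show "\<forall>b\<in>B. openin X {x \<in> topspace X. f x g = b}"
      by simp
  next
    assume o: "\<forall>b\<in>B. openin X {x \<in> topspace X. f x g = b}"
    have "openin X {x \<in> topspace X. f x g \<in> V}" if "V \<subseteq> B" for V
    proof -
      have "{x \<in> topspace X. f x g \<in> V} = (\<Union>b\<in>V. {x \<in> topspace X. f x g = b})"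
        by blast
      then show ?thesis
        using o that by (auto intro!: openin_Union)
    qed
    moreover have "f x g \<in> B" if "x \<in> topspace X" for x
      using assms that g by (auto simp: full_shift_def PiE_iff)
    ultimately show "continuous_map X (discrete_topology B) (\<lambda>x. f x g)"
      by (auto simp: continuous_map_def)
  qed
  with ext show ?thesis
    by (auto simp: shift_topology_def continuous_map_componentwise)
qed

text \<open>Removes the definite description: by invariance the translate lies in \<Lambda>, so the
  partition puts it in exactly one block.\<close>

lemma generalized_sliding_block_code_iff:
  assumes "monoid M" "shift_space M A \<Lambda>" "\<Phi> \<in> \<Lambda> \<rightarrow> full_shift M B"
  shows "generalized_sliding_block_code M A B \<Lambda> \<Phi> \<longleftrightarrow>
    (\<exists>C. disjoint_family_on C B \<and> (\<Union>b\<in>B. C b) = \<Lambda> \<and>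
      (\<forall>b\<in>B. openin (subtopology (shift_topology M A) \<Lambda>) (C b)) \<and>
      (\<forall>x\<in>\<Lambda>. \<forall>g\<in>carrier M. \<forall>b\<in>B. \<Phi> x g = b \<longleftrightarrow> translation M g x \<in> C b))"
proof -
  have the_iff: "\<Phi> x g = (THE b. b \<in> B \<and> translation M g x \<in> C b) \<longleftrightarrow>
      (\<forall>b\<in>B. \<Phi> x g = b \<longleftrightarrow> translation M g x \<in> C b)"
    if C: "disjoint_family_on C B" "(\<Union>b\<in>B. C b) = \<Lambda>" and x: "x \<in> \<Lambda>" and g: "g \<in> carrier M"
    for C x g
  proof -
    obtain c where c: "c \<in> B" "translation M g x \<in> C c"
      using shift_space_translation[OF assms(2) g x] C(2) by blast
    have uniq: "b = c" if "b \<in> B" "translation M g x \<in> C b" for b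
      using that c C(1) by (auto simp: disjoint_family_on_def)
    have "(THE b. b \<in> B \<and> translation M g x \<in> C b) = c"
      using c uniq by blast
    \<comment> \<open>From right to left, the equivalence is instantiated at
      \<open>b = c\<close>.\<close>
    then show ?thesis
      using c uniq by metis
  qed
  show ?thesis
    \<comment> \<open>After the unfolding, an empty block is covered by openness of the empty
      set.\<close>
    unfolding generalized_sliding_block_code_def openin_iff_Union_cylinders_of[symmetric]
    by (rule ex_cong1, intro conj_cong refl ball_cong the_iff) auto
qed

theorem theorem5:
  fixes M :: "('m, 'z) monoid_scheme"
    and A :: "'a set" and B :: "'b set"
    and \<Lambda> :: "('m \<Rightarrow> 'a) set"
    and \<Phi> :: "('m \<Rightarrow> 'a) \<Rightarrow> 'm \<Rightarrow> 'b"
  assumes "monoid M"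
    and "countable A" and "countable B"
    and "shift_space M A \<Lambda>"
    and "\<Phi> \<in> \<Lambda> \<rightarrow> full_shift M B"
  shows "generalized_sliding_block_code M A B \<Lambda> \<Phi> \<longleftrightarrow>
           continuous_map (subtopology (shift_topology M A) \<Lambda>) (shift_topology M B) \<Phi> \<and>
           (\<forall>g\<in>carrier M. \<forall>x\<in>\<Lambda>. \<Phi> (translation M g x) = translation M g (\<Phi> x))"
proof -
  interpret monoid M by fact
  let ?X = "subtopology (shift_topology M A) \<Lambda>"
  have top: "topspace ?X = \<Lambda>"
    using shift_space_subset[OF assms(4)] by (auto simp: topspace_shift_topology)
  have cont_iff: "continuous_map ?X (shift_topology M B) \<Phi> \<longleftrightarrow>
      (\<forall>g\<in>carrier M. \<forall>b\<in>B. openin ?X {x \<in> \<Lambda>. \<Phi> x g = b})"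
    using continuous_map_into_shift_topology[of \<Phi> ?X M B] assms(5) unfolding top by blast
  have in_B: "\<Phi> x g \<in> B" if "x \<in> \<Lambda>" "g \<in> carrier M" for x g
    using assms(5) that by (auto simp: full_shift_def PiE_iff)
  note trans = shift_space_translation[OF assms(4)]
  show ?thesis
    unfolding generalized_sliding_block_code_iff[OF assms(1,4,5)]
  proof (intro iffI conjI; (elim exE conjE)?)
    fix C
    assume openC: "\<forall>b\<in>B. openin ?X (C b)"
      and C: "\<forall>x\<in>\<Lambda>. \<forall>g\<in>carrier M. \<forall>b\<in>B. \<Phi> x g = b \<longleftrightarrow> translation M g x \<in> C b"
    have "openin ?X {x \<in> \<Lambda>. \<Phi> x g = b}" if "g \<in> carrier M" "b \<in> B" for g b
    proof -
      \<comment> \<open>The fibre at \<open>g\<close> is the preimage of a single block under a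
        continuous translation.\<close>
      have "{x \<in> \<Lambda>. \<Phi> x g = b} = {x \<in> topspace ?X. translation M g x \<in> C b}"
        using C that unfolding top by blast
      then show ?thesis
        using openin_continuous_map_preimage[OF continuous_map_translation_shift_space[OF assms(4)]]
          openC that by simp
    qed
    then show "continuous_map ?X (shift_topology M B) \<Phi>"
      unfolding cont_iff by blast
    show "\<forall>g\<in>carrier M. \<forall>x\<in>\<Lambda>. \<Phi> (translation M g x) = translation M g (\<Phi> x)"
    \<comment> \<open>Both sides are extensional, so agreement at every \<open>h\<close> in the
      carrier suffices.\<close>
    proof (intro ballI extensionalityI[of _ "carrier M"])
      fix g x h
      assume g: "g \<in> carrier M" and x: "x \<in> \<Lambda>" and h: "h \<in> carrier M"
      have gh: "g \<otimes>\<^bsub>M\<^esub> h \<in> carrier M"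
        using g h by simp
      \<comment> \<open>Translating by \<open>g\<close> and then by \<open>h\<close> reaches the
        same point as translating by the product. Its block therefore determines both
        \<open>\<Phi> x\<close> at the product and \<open>\<Phi> (translation M g x)\<close> at
        \<open>h\<close>.\<close>
      then have "translation M h (translation M g x) \<in> C (\<Phi> x (g \<otimes>\<^bsub>M\<^esub> h))"
        unfolding translation_translation[OF g h] using C x in_B by blast
      then have "\<Phi> (translation M g x) h = \<Phi> x (g \<otimes>\<^bsub>M\<^esub> h)"
        using C trans[OF g x] in_B[OF x gh] h by blast
      then show "\<Phi> (translation M g x) h = translation M g (\<Phi> x) h"
        using h by (simp add: translation_def)
    next
      fix g x
      assume "g \<in> carrier M" "x \<in> \<Lambda>"
      then have "\<Phi> (translation M g x) \<in> full_shift M B"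
        using assms(5) trans by blast
      then show "\<Phi> (translation M g x) \<in> extensional (carrier M)"
        by (simp add: full_shift_def PiE_iff)
    qed (simp add: translation_def)
  next
    assume cont: "continuous_map ?X (shift_topology M B) \<Phi>"
      and comm: "\<forall>g\<in>carrier M. \<forall>x\<in>\<Lambda>. \<Phi> (translation M g x) = translation M g (\<Phi> x)"
    define C where "C b = {x \<in> \<Lambda>. \<Phi> x \<one>\<^bsub>M\<^esub> = b}" for b
    have "disjoint_family_on C B"
      by (auto simp: disjoint_family_on_def C_def)
    moreover have "(\<Union>b\<in>B. C b) = \<Lambda>"
      using in_B by (auto simp: C_def)
    moreover have "openin ?X (C b)" if "b \<in> B" for b
      using cont that unfolding cont_iff C_def by blast
    moreover have "\<Phi> x g = b \<longleftrightarrow> translation M g x \<in> C b"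
      if x: "x \<in> \<Lambda>" and g: "g \<in> carrier M" for x g b
    proof -
      \<comment> \<open>Commutation carries coordinate \<open>g\<close> to the identity, where the
        blocks are defined; the next equality uses that the identity is a right unit.\<close>
      have "\<Phi> (translation M g x) \<one>\<^bsub>M\<^esub> = translation M g (\<Phi> x) \<one>\<^bsub>M\<^esub>"
        using comm x g by simp
      also have "\<dots> = \<Phi> x g"
        using g by (simp add: translation_def)
      finally show ?thesis
        using trans[OF g x] by (simp add: C_def)
    qed
    ultimately show "\<exists>C. disjoint_family_on C B \<and> (\<Union>b\<in>B. C b) = \<Lambda> \<and>
        (\<forall>b\<in>B. openin ?X (C b)) \<and>
        (\<forall>x\<in>\<Lambda>. \<forall>g\<in>carrier M. \<forall>b\<in>B. \<Phi> x g = b \<longleftrightarrow> translation M g x \<in> C b)"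
      by (intro exI[of _ C] conjI ballI)
  qed
qed

end
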